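(* Let $k\ge 2$, $\ell\ge 1$ and $0<\varepsilon\le 1/(9\ell^2k^4)$. Let $G_1,\dots,G_\ell$ be finite graphs on the same vertex set $V$, where $G_i$ has $m_i$ edges and maximum degree $\Delta(G_i)\le \varepsilon m_i$ for all $i=1,\dots,\ell$. Then there is a partition of $V$ into $k$ classes $V_1,\dots,V_k$ such that for all $i=1,\dots,\ell$ and all $s,t$ with $1\le s<t\le k$, $$e_{G_i}(V_s,V_t)\ge \frac{2m_i}{k^2}-\varepsilon^{1/4}m_i,$$ and for all $i=1,\dots,\ell$ and all $s=1,\dots,k$, $$e_{G_i}(V_s)\ge \frac{m_i}{k^2}-\varepsilon^{1/4}m_i.$$
   Context: Graphs are finite and simple. For disjoint vertex sets $A,B$ of a graph $G$, $e_G(A,B)$ is the number of edges of $G$ with one endvertex in $A$ and the other in $B$; $e_G(A)$ is the number of edges of the subgraph of $G$ induced by $A$. A partition of $V$ into $k$ classes means pairwise disjoint sets $V_1,\dots,V_k$ with union $V$ (classes are allowed to be empty). *)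

theory Defs
  imports Complex_Main "HOL-Library.Disjoint_Sets"
begin

text \<open>A graph is given by its vertex set \<open>V\<close> and its set \<open>E\<close> of edges, where an edge is a
  two-element subset of \<open>V\<close>.\<close>

definition simple_graph :: "'a set \<Rightarrow> 'a set set \<Rightarrow> bool" where
  "simple_graph V E \<longleftrightarrow> finite V \<and> (\<forall>e\<in>E. e \<subseteq> V \<and> card e = 2)"

definition degree :: "'a set set \<Rightarrow> 'a \<Rightarrow> nat" where
  "degree E v = card {e \<in> E. v \<in> e}"

text \<open>Inserting 0 only matters when \<open>V\<close> is empty; the maximum degree is then 0.\<close>

definition max_degree :: "'a set \<Rightarrow> 'a set set \<Rightarrow> nat" where
  "max_degree V E = Max (insert 0 (degree E ` V))"

definition edges_between :: "'a set set \<Rightarrow> 'a set \<Rightarrow> 'a set \<Rightarrow> nat" where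
  "edges_between E A B = card {e \<in> E. \<exists>a\<in>A. \<exists>b\<in>B. e = {a, b}}"

definition edges_within :: "'a set set \<Rightarrow> 'a set \<Rightarrow> nat" where
  "edges_within E A = card {e \<in> E. e \<subseteq> A}"

text \<open>The classes are indexed by \<open>1, \<dots>, k\<close> and may be empty, unlike the blocks in
  \<^const>\<open>partition_on\<close>.\<close>

definition partition_into :: "nat \<Rightarrow> 'a set \<Rightarrow> (nat \<Rightarrow> 'a set) \<Rightarrow> bool" where
  "partition_into k V P \<longleftrightarrow> disjoint_family_on P {1..k} \<and> (\<Union>s\<in>{1..k}. P s) = V"

end

theory Submission
  imports Defs "HOL-Library.FuncSet"
begin

text \<open>Colour the vertices independently and uniformly with \<open>k\<close> colours. For a fixed graph and a fixed
  set \<open>{s, t}\<close> of one or two colours, count the edges whose endvertices receive exactly these colours.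
  The indicators of disjoint edges are uncorrelated, and at most \<open>2 m \<Delta> \<le> 2 \<epsilon> m\<^sup>2\<close> ordered pairs of
  edges meet, so this count has variance at most \<open>2 \<epsilon> m\<^sup>2\<close>. By Chebyshev's inequality it lies more
  than \<open>\<epsilon>\<^bsup>1/4\<^esup> m\<close> below its mean with probability at most \<open>2 \<surd>\<epsilon> \<le> 2 / (3 \<ell> k\<^sup>2)\<close>, and the union
  bound over the at most \<open>\<ell> k\<^sup>2\<close> events leaves a good colouring.\<close>

section \<open>Counting colourings with prescribed colours on edges\<close>

lemma card_PiE_split:
  assumes "U \<subseteq> V"
  shows "card {c \<in> V \<rightarrow>\<^sub>E K. Q (restrict c U) \<and> R (restrict c (V - U))} =
    card {c \<in> U \<rightarrow>\<^sub>E K. Q c} * card {c \<in> V - U \<rightarrow>\<^sub>E K. R c}"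
    (is "card ?S = card ?A * card ?B")
proof -
  \<comment> \<open>Independence in counting form: \<open>Q\<close> and \<open>R\<close> see only
    the restrictions to complementary sets, and gluing two partial colourings with \<open>?g\<close>
    inverts restricting, so the count factors.\<close>
  let ?f = "\<lambda>c. (restrict c U, restrict c (V - U))"
  let ?g = "\<lambda>(a, b). \<lambda>x. if x \<in> U then a x else b x"
  have restrict_eqs: "restrict (?g (a, b)) U = a" "restrict (?g (a, b)) (V - U) = b"
    if "a \<in> ?A" "b \<in> ?B" for a b
    using that by (auto simp: fun_eq_iff restrict_def PiE_def extensional_def)
  have g_mem: "?g (a, b) \<in> V \<rightarrow>\<^sub>E K" if "a \<in> ?A" "b \<in> ?B" for a b
    using that assms by (auto simp: PiE_iff extensional_def)
  have "bij_betw ?f ?S (?A \<times> ?B)"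
  proof (rule bij_betw_byWitness[where f' = ?g])
    show "\<forall>c\<in>?S. ?g (?f c) = c"
      using assms by (auto simp: fun_eq_iff restrict_def PiE_def extensional_def)
    show "\<forall>ab\<in>?A \<times> ?B. ?f (?g ab) = ab"
      using restrict_eqs by auto
    show "?f ` ?S \<subseteq> ?A \<times> ?B"
      using assms by (auto simp: PiE_iff)
    show "?g ` (?A \<times> ?B) \<subseteq> ?S"
    proof
      fix c assume "c \<in> ?g ` (?A \<times> ?B)"
      then obtain a b where ab: "a \<in> ?A" "b \<in> ?B" and c: "c = ?g (a, b)"
        by auto
      show "c \<in> ?S"
        unfolding c using g_mem[OF ab] ab by (simp only: restrict_eqs[OF ab] mem_Collect_eq)
    qed
  qed
  then show ?thesis
    by (simp add: bij_betw_same_card card_cartesian_product)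
qed

lemma card_colourings_image:
  assumes "finite V" "e \<subseteq> V"
  shows "card {c \<in> V \<rightarrow>\<^sub>E K. c ` e = T} =
    card {c \<in> e \<rightarrow>\<^sub>E K. c ` e = T} * card K ^ (card V - card e)"
proof -
  have "card {c \<in> V - e \<rightarrow>\<^sub>E K. True} = card K ^ (card V - card e)"
    using assms by (simp add: card_funcsetE card_Diff_subset finite_subset)
  then show ?thesis
    using card_PiE_split[OF assms(2), of K "\<lambda>c. c ` e = T" "\<lambda>_. True"] by simp
qed

text \<open>Once \<open>e\<close> is split off, \<open>f\<close> still lies in \<open>V - e\<close>,
  so the one-edge count applies again to the remaining vertices.\<close>

lemma card_colourings_image2:
  assumes "finite V" "e \<subseteq> V" "f \<subseteq> V" "e \<inter> f = {}"
  shows "card {c \<in> V \<rightarrow>\<^sub>E K. c ` e = T \<and> c ` f = T} =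
    card {c \<in> e \<rightarrow>\<^sub>E K. c ` e = T} * card {c \<in> f \<rightarrow>\<^sub>E K. c ` f = T} *
    card K ^ (card V - card e - card f)"
proof -
  have f: "f \<subseteq> V - e" "finite (V - e)" "card (V - e) = card V - card e"
    using assms by (auto simp: card_Diff_subset finite_subset)
  have "restrict c (V - e) ` f = c ` f" for c :: "'a \<Rightarrow> 'b"
    using f(1) by (intro image_cong) auto
  then have "card {c \<in> V \<rightarrow>\<^sub>E K. c ` e = T \<and> c ` f = T} =
      card {c \<in> e \<rightarrow>\<^sub>E K. c ` e = T} * card {c \<in> V - e \<rightarrow>\<^sub>E K. c ` f = T}"
    using card_PiE_split[OF assms(2), of K "\<lambda>c. c ` e = T" "\<lambda>c. c ` f = T"] by simp
  then show ?thesis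
    using card_colourings_image[OF f(2,1), of K T] f(3) by simp
qed

lemma card_edge_colourings:
  assumes "card e = 2" "s \<in> K" "t \<in> K"
  shows "card {c \<in> e \<rightarrow>\<^sub>E K. c ` e = {s, t}} = card {s, t}"
proof -
  obtain u v where e: "e = {u, v}" "u \<noteq> v"
    using assms(1) by (auto simp: card_2_iff)
  \<comment> \<open>The colour of \<open>u\<close> fixes that of the other endvertex: it is the
    other element of \<open>{s, t}\<close>, or the same colour if s = t. The inverse handles both
    cases, since for s = t the expression \<open>if r = s then t else s\<close> returns
    \<open>s\<close> when r = s.\<close>
  have "bij_betw (\<lambda>c. c u) {c \<in> e \<rightarrow>\<^sub>E K. c ` e = {s, t}} {s, t}"
  proof (rule bij_betw_byWitness[where
        f' = "\<lambda>r. \<lambda>x\<in>e. if x = u then r else if r = s then t else s"])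
    show "\<forall>c\<in>{c \<in> e \<rightarrow>\<^sub>E K. c ` e = {s, t}}.
        (\<lambda>x\<in>e. if x = u then c u else if c u = s then t else s) = c"
      using e by (auto simp: fun_eq_iff restrict_def PiE_iff extensional_def doubleton_eq_iff)
  qed (use e assms in \<open>auto simp: PiE_iff\<close>)
  then show ?thesis
    by (rule bij_betw_same_card)
qed

section \<open>Edge indicators and their first two moments\<close>

definition hits :: "'b set \<Rightarrow> ('a \<Rightarrow> 'b) \<Rightarrow> 'a set \<Rightarrow> real" where
  "hits T c e = of_bool (c ` e = T)"

text \<open>The colours enter as the set \<open>{s, t}\<close>, so s = t is the monochromatic case
  and one computation serves edges between classes and edges within a class. Expectations appear
  multiplied by the number of colourings.\<close>

lemma sum_hits:
  assumes "finite V" "finite K" "e \<subseteq> V" "card e = 2" "s \<in> K" "t \<in> K"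
  shows "(\<Sum>c\<in>V \<rightarrow>\<^sub>E K. hits {s, t} c e) =
    real (card {s, t}) / real (card K) ^ 2 * real (card (V \<rightarrow>\<^sub>E K))"
proof -
  have K: "card K > 0" and V: "2 \<le> card V"
    using assms card_gt_0_iff card_mono[of V e] by auto
  \<comment> \<open>The bound \<open>2 \<le> card V\<close> makes the natural-number exponent a
    genuine difference.\<close>
  then have power: "real (card K) ^ (card V - 2) = real (card K) ^ card V / real (card K) ^ 2"
    by (intro power_diff) auto
  have "(\<Sum>c\<in>V \<rightarrow>\<^sub>E K. hits {s, t} c e) = real (card {c \<in> V \<rightarrow>\<^sub>E K. c ` e = {s, t}})"
    using assms by (simp add: hits_def sum_of_bool_eq finite_PiE Int_def)
  also have "\<dots> = real (card {s, t}) * real (card K) ^ (card V - 2)"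
    using assms by (simp add: card_colourings_image card_edge_colourings)
  also have "\<dots> = real (card {s, t}) / real (card K) ^ 2 * real (card (V \<rightarrow>\<^sub>E K))"
    using power assms by (simp add: card_funcsetE)
  finally show ?thesis .
qed

text \<open>The joint probability is the square of the single one, so the indicators of disjoint
  edges are uncorrelated.\<close>

lemma sum_hits_mult:
  assumes "finite V" "finite K" "e \<subseteq> V" "card e = 2" "f \<subseteq> V" "card f = 2" "e \<inter> f = {}"
    and "s \<in> K" "t \<in> K"
  shows "(\<Sum>c\<in>V \<rightarrow>\<^sub>E K. hits {s, t} c e * hits {s, t} c f) =
    (real (card {s, t}) / real (card K) ^ 2) ^ 2 * real (card (V \<rightarrow>\<^sub>E K))"
proof -
  have K: "card K > 0"
    using assms card_gt_0_iff by auto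
  have "card (e \<union> f) = 4"
    using assms by (subst card_Un_disjoint) (auto intro: finite_subset)
  then have V: "4 \<le> card V"
    using assms card_mono[of V "e \<union> f"] by auto
  then have power: "real (card K) ^ (card V - 4) = real (card K) ^ card V / real (card K) ^ 4"
    using K by (intro power_diff) auto
  have "(\<Sum>c\<in>V \<rightarrow>\<^sub>E K. hits {s, t} c e * hits {s, t} c f) =
      (\<Sum>c\<in>V \<rightarrow>\<^sub>E K. of_bool (c ` e = {s, t} \<and> c ` f = {s, t}))"
    by (simp add: hits_def flip: of_bool_conj)
  also have "\<dots> = real (card {c \<in> V \<rightarrow>\<^sub>E K. c ` e = {s, t} \<and> c ` f = {s, t}})"
    using assms by (subst sum_of_bool_eq) (simp_all add: finite_PiE Int_def)
  also have "\<dots> = real (card {s, t}) ^ 2 * real (card K) ^ (card V - 4)"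
    using assms by (simp add: card_colourings_image2 card_edge_colourings power2_eq_square)
  also have "\<dots> = (real (card {s, t}) / real (card K) ^ 2) ^ 2 * real (card (V \<rightarrow>\<^sub>E K))"
    using power assms by (simp add: card_funcsetE power_divide)
  finally show ?thesis .
qed

section \<open>Variance and lower tail of the edge counts\<close>

lemma simple_graph_finite_edges:
  assumes "simple_graph V E"
  shows "finite E"
  using assms by (intro finite_subset[of E "Pow V"]) (auto simp: simple_graph_def)

text \<open>An edge meeting \<open>e\<close> contains one of its two endvertices. The count includes
  \<open>e\<close> itself, so it also covers the diagonal terms of the variance.\<close>

lemma card_meeting_edges_le:
  assumes "simple_graph V E" "e \<in> E"
  shows "card {f \<in> E. e \<inter> f \<noteq> {}} \<le> 2 * max_degree V E"
proof -
  have e: "finite V" "e \<subseteq> V" "card e = 2"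
    using assms by (auto simp: simple_graph_def)
  have "{f \<in> E. e \<inter> f \<noteq> {}} = (\<Union>v\<in>e. {f \<in> E. v \<in> f})"
    by auto
  also have "card \<dots> \<le> (\<Sum>v\<in>e. degree E v)"
    unfolding degree_def using e by (intro card_UN_le) (auto intro: finite_subset)
  also have "\<dots> \<le> (\<Sum>v\<in>e. max_degree V E)"
    unfolding max_degree_def using e by (intro sum_mono Max_ge) auto
  finally show ?thesis
    using e by simp
qed

lemma sum_hits_variance_le:
  assumes E: "simple_graph V E" and K: "finite K" "2 \<le> card K" and st: "s \<in> K" "t \<in> K"
  defines "p \<equiv> real (card {s, t}) / real (card K) ^ 2"
  shows "(\<Sum>c\<in>V \<rightarrow>\<^sub>E K. ((\<Sum>e\<in>E. hits {s, t} c e) - p * real (card E)) ^ 2) \<le>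
    2 * real (card E) * real (max_degree V E) * real (card (V \<rightarrow>\<^sub>E K))"
proof -
  let ?C = "V \<rightarrow>\<^sub>E K" and ?h = "hits {s, t}"
  have edge: "e \<subseteq> V" "card e = 2" if "e \<in> E" for e
    using E that by (auto simp: simple_graph_def)
  have finV: "finite V"
    using E by (simp add: simple_graph_def)
  have finE: "finite E"
    using E by (rule simple_graph_finite_edges)
  \<comment> \<open>Knowing that \<open>p\<close> lies in [0, 1] gives |\<open>?h c e - p\<close>|
    \<le> 1, which is all that is used about edges that meet.\<close>
  have "card {s, t} \<le> 2"
    by (simp add: card_insert_if)
  moreover have "2 \<le> card K ^ 2"
    using K(2) power_mono[of 2 "card K" 2] by simp
  ultimately have p: "0 \<le> p" "p \<le> 1"
    unfolding p_def by (auto simp: divide_simps simp flip: of_nat_power)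
  have cov: "(\<Sum>c\<in>?C. (?h c e - p) * (?h c f - p)) \<le> real (card ?C) * of_bool (e \<inter> f \<noteq> {})"
    if ef: "e \<in> E" "f \<in> E" for e f
  proof (cases "e \<inter> f = {}")
    case True
    note sums = sum_hits[OF finV K(1) edge[OF ef(1)] st] sum_hits[OF finV K(1) edge[OF ef(2)] st]
      sum_hits_mult[OF finV K(1) edge[OF ef(1)] edge[OF ef(2)] True st]
    have "(\<Sum>c\<in>?C. (?h c e - p) * (?h c f - p)) =
        (\<Sum>c\<in>?C. ?h c e * ?h c f - p * ?h c f - p * ?h c e + p * p)"
      by (simp add: algebra_simps)
    also have "\<dots> = (\<Sum>c\<in>?C. ?h c e * ?h c f) - p * (\<Sum>c\<in>?C. ?h c f) -
        p * (\<Sum>c\<in>?C. ?h c e) + real (card ?C) * (p * p)"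
      by (simp add: sum.distrib sum_subtractf sum_distrib_left)
    \<comment> \<open>Divided by \<open>card ?C\<close>, the four terms are p^2 - p^2 - p^2 +
      p^2.\<close>
    also have "\<dots> = 0"
      unfolding sums p_def[symmetric] by (simp add: algebra_simps power2_eq_square)
    finally show ?thesis
      using True by simp
  next
    case False
    have "(?h c e - p) * (?h c f - p) \<le> 1" for c
    proof -
      have "\<bar>?h c e - p\<bar> * \<bar>?h c f - p\<bar> \<le> 1 * 1"
        using p by (intro mult_mono) (auto simp: hits_def)
      then show ?thesis
        by (simp flip: abs_mult)
    qed
    then have "(\<Sum>c\<in>?C. (?h c e - p) * (?h c f - p)) \<le> (\<Sum>c\<in>?C. 1)"
      by (intro sum_mono)
    then show ?thesis
      using False by simp
  qed
  \<comment> \<open>Here \<open>p * real (card E)\<close> is absorbed as one \<open>p\<close> per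
    edge. The square becomes a sum over ordered pairs of edges, and moving the sum over colourings
    innermost exposes the covariances.\<close>
  have "(\<Sum>c\<in>?C. ((\<Sum>e\<in>E. ?h c e) - p * real (card E)) ^ 2) =
      (\<Sum>c\<in>?C. \<Sum>e\<in>E. \<Sum>f\<in>E. (?h c e - p) * (?h c f - p))"
    unfolding sum_product[symmetric] by (simp add: sum_subtractf power2_eq_square mult.commute)
  also have "\<dots> = (\<Sum>e\<in>E. \<Sum>c\<in>?C. \<Sum>f\<in>E. (?h c e - p) * (?h c f - p))"
    by (rule sum.swap)
  also have "\<dots> = (\<Sum>e\<in>E. \<Sum>f\<in>E. \<Sum>c\<in>?C. (?h c e - p) * (?h c f - p))"
    by (intro sum.cong refl sum.swap)
  also have "\<dots> \<le> (\<Sum>e\<in>E. \<Sum>f\<in>E. real (card ?C) * of_bool (e \<inter> f \<noteq> {}))"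
    by (intro sum_mono cov)
  also have "\<dots> = (\<Sum>e\<in>E. real (card ?C) * real (card {f \<in> E. e \<inter> f \<noteq> {}}))"
    using finE by (simp add: sum_of_bool_eq Int_def flip: sum_distrib_left)
  also have "\<dots> \<le> (\<Sum>e\<in>E. real (card ?C) * real (2 * max_degree V E))"
    using card_meeting_edges_le[OF E] by (intro sum_mono mult_left_mono of_nat_mono) auto
  finally show ?thesis
    by (simp add: mult_ac)
qed

text \<open>This is Chebyshev's inequality in counting form, for the lower tail.\<close>

lemma card_bad_colourings_le:
  assumes E: "simple_graph V E" and K: "finite K" "2 \<le> card K" and st: "s \<in> K" "t \<in> K"
    and \<epsilon>: "0 < \<epsilon>" and \<Delta>: "real (max_degree V E) \<le> \<epsilon> * real (card E)"
  shows "real (card {c \<in> V \<rightarrow>\<^sub>E K. (\<Sum>e\<in>E. hits {s, t} c e) <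
      real (card {s, t}) / real (card K) ^ 2 * real (card E) - \<epsilon> powr (1/4) * real (card E)})
    \<le> 2 * sqrt \<epsilon> * real (card (V \<rightarrow>\<^sub>E K))" (is "real (card ?B) \<le> _")
\<comment> \<open>The argument ends by cancelling \<open>sqrt \<epsilon> * ?m ^ 2\<close>, so m = 0
  is separate; there no colouring is bad, a sum of indicators being nonnegative.\<close>
proof (cases "card E = 0")
  case True
  then have no_bad: "?B = {}"
    by (auto simp: hits_def not_less intro!: sum_nonneg)
  show ?thesis
    unfolding no_bad using \<epsilon> by simp
next
  case False
  let ?m = "real (card E)" and ?C = "V \<rightarrow>\<^sub>E K" and ?p = "real (card {s, t}) / real (card K) ^ 2"
  have finC: "finite ?C"
    using E K by (auto simp: simple_graph_def intro!: finite_PiE)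
  have quarter: "(\<epsilon> powr (1/4)) ^ 2 = sqrt \<epsilon>"
    using \<epsilon> by (simp add: powr_powr powr_half_sqrt flip: powr_numeral)
  \<comment> \<open>Each bad colouring contributes at least \<open>sqrt \<epsilon> * ?m ^ 2\<close>
    to the sum of squared deviations.\<close>
  have "real (card ?B) * (sqrt \<epsilon> * ?m ^ 2) = (\<Sum>c\<in>?B. (\<epsilon> powr (1/4) * ?m) ^ 2)"
    by (simp add: power_mult_distrib quarter)
  also have "\<dots> \<le> (\<Sum>c\<in>?B. (?p * ?m - (\<Sum>e\<in>E. hits {s, t} c e)) ^ 2)"
    by (intro sum_mono power_mono) auto
  also have "\<dots> \<le> (\<Sum>c\<in>?C. ((\<Sum>e\<in>E. hits {s, t} c e) - ?p * ?m) ^ 2)"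
    using finC by (subst power2_commute) (auto intro!: sum_mono2)
  also have "\<dots> \<le> 2 * ?m * real (max_degree V E) * real (card ?C)"
    by (rule sum_hits_variance_le[OF E K st])
  also have "\<dots> \<le> 2 * ?m * (\<epsilon> * ?m) * real (card ?C)"
    using \<Delta> by (intro mult_right_mono mult_left_mono) auto
  \<comment> \<open>Writing \<epsilon> as \<open>sqrt \<epsilon> * sqrt \<epsilon>\<close> leaves
    one factor \<open>sqrt \<epsilon>\<close> in the bound after cancelling.\<close>
  also have "\<dots> = 2 * sqrt \<epsilon> * real (card ?C) * (sqrt \<epsilon> * ?m ^ 2)"
    using \<epsilon> by (simp add: power2_eq_square)
  finally show ?thesis
    using \<epsilon> False by (simp add: mult_le_cancel_right)
qed

section \<open>Edge counts of colour classes as sums of indicators\<close>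

lemma edges_between_colour_classes:
  assumes "simple_graph V E" "s \<noteq> t"
  shows "real (edges_between E {v \<in> V. c v = s} {v \<in> V. c v = t}) = (\<Sum>e\<in>E. hits {s, t} c e)"
proof -
  have finE: "finite E"
    using assms(1) by (rule simple_graph_finite_edges)
  have "(\<exists>a\<in>{v \<in> V. c v = s}. \<exists>b\<in>{v \<in> V. c v = t}. e = {a, b}) \<longleftrightarrow> c ` e = {s, t}"
    if "e \<in> E" for e
  proof -
    have "e \<subseteq> V" "card e = 2"
      using assms(1) that by (auto simp: simple_graph_def)
    then obtain u v where "e = {u, v}" "u \<in> V" "v \<in> V"
      by (auto simp: card_2_iff)
    then show ?thesis
      using assms(2) by (auto simp: doubleton_eq_iff)
  qed
  then have "{e \<in> E. \<exists>a\<in>{v \<in> V. c v = s}. \<exists>b\<in>{v \<in> V. c v = t}. e = {a, b}} =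
      {e \<in> E. c ` e = {s, t}}"
    by blast
  then show ?thesis
    using finE by (simp add: edges_between_def hits_def sum_of_bool_eq Int_def)
qed

lemma edges_within_colour_class:
  assumes "simple_graph V E"
  shows "real (edges_within E {v \<in> V. c v = s}) = (\<Sum>e\<in>E. hits {s, s} c e)"
proof -
  have finE: "finite E"
    using assms(1) by (rule simple_graph_finite_edges)
  have "e \<subseteq> {v \<in> V. c v = s} \<longleftrightarrow> c ` e = {s, s}" if "e \<in> E" for e
    using assms that by (auto simp: simple_graph_def card_2_iff)
  then have "{e \<in> E. e \<subseteq> {v \<in> V. c v = s}} = {e \<in> E. c ` e = {s, s}}"
    by blast
  then show ?thesis
    using finE by (simp add: edges_within_def hits_def sum_of_bool_eq Int_def)
qed

theorem theorem3:
  fixes k l :: nat and \<epsilon> :: real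
    and V :: "'a set" and E :: "nat \<Rightarrow> 'a set set" and m :: "nat \<Rightarrow> nat"
  assumes "k \<ge> 2" and "l \<ge> 1"
    and "0 < \<epsilon>" and "\<epsilon> \<le> 1 / (9 * real l ^ 2 * real k ^ 4)"
    and "\<And>i. i \<in> {1..l} \<Longrightarrow> simple_graph V (E i)"
    and "\<And>i. i \<in> {1..l} \<Longrightarrow> card (E i) = m i"
    and "\<And>i. i \<in> {1..l} \<Longrightarrow> real (max_degree V (E i)) \<le> \<epsilon> * real (m i)"
  shows "\<exists>P :: nat \<Rightarrow> 'a set. partition_into k V P \<and>
    (\<forall>i\<in>{1..l}. \<forall>s t. 1 \<le> s \<and> s < t \<and> t \<le> k \<longrightarrow>
      real (edges_between (E i) (P s) (P t))
        \<ge> 2 * real (m i) / real k ^ 2 - \<epsilon> powr (1/4) * real (m i)) \<and>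
    (\<forall>i\<in>{1..l}. \<forall>s\<in>{1..k}.
      real (edges_within (E i) (P s))
        \<ge> real (m i) / real k ^ 2 - \<epsilon> powr (1/4) * real (m i))"
proof -
  let ?K = "{1..k}"
  let ?C = "V \<rightarrow>\<^sub>E ?K"
  \<comment> \<open>Ordered pairs, diagonal included, list each event with s \<noteq> t twice; the
    union bound can afford this.\<close>
  let ?I = "{1..l} \<times> ?K \<times> ?K"
  define bad where "bad = (\<lambda>(i, s, t). {c \<in> ?C. (\<Sum>e\<in>E i. hits {s, t} c e) <
    real (card {s, t}) / real k ^ 2 * real (m i) - \<epsilon> powr (1/4) * real (m i)})"
  have finV: "finite V"
    using assms(2) assms(5)[of 1] by (simp add: simple_graph_def)
  have finC: "finite ?C" and C_pos: "card ?C > 0"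
    using finV assms(1) by (auto simp: card_funcsetE intro!: finite_PiE)
  \<comment> \<open>The hypothesis on \<epsilon> has the square of \<open>3 * l * k ^ 2\<close> as
    its denominator.\<close>
  have "sqrt \<epsilon> \<le> sqrt ((1 / (3 * real l * real k ^ 2)) ^ 2)"
    using assms(4) by (intro real_sqrt_le_mono) (simp add: field_simps power_mult_distrib flip: power_mult)
  then have sqrt_eps: "sqrt \<epsilon> \<le> 1 / (3 * real l * real k ^ 2)"
    by simp
  have bad_le: "real (card (bad x)) \<le> 2 * sqrt \<epsilon> * real (card ?C)" if "x \<in> ?I" for x
    using that assms(1) card_bad_colourings_le[of V "E (fst x)" ?K "fst (snd x)" "snd (snd x)" \<epsilon>]
      assms(3,5,6,7) by (auto simp: bad_def)
  have "real (card (\<Union>x\<in>?I. bad x)) \<le> (\<Sum>x\<in>?I. real (card (bad x)))"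
    unfolding of_nat_sum[symmetric] by (intro of_nat_mono card_UN_le) auto
  also have "\<dots> \<le> (\<Sum>x\<in>?I. 2 * sqrt \<epsilon> * real (card ?C))"
    by (intro sum_mono bad_le)
  also have "\<dots> = real l * real k ^ 2 * (2 * sqrt \<epsilon>) * real (card ?C)"
    by (simp add: card_cartesian_product power2_eq_square)
  \<comment> \<open>There are l k^2 events, each of probability at most 2 / (3 l k^2), which leaves
    a third of the colourings.\<close>
  also have "\<dots> \<le> 2 / 3 * real (card ?C)"
    using sqrt_eps assms(1,2) by (intro mult_right_mono) (auto simp: field_simps)
  also have "\<dots> < real (card ?C)"
    using C_pos by simp
  finally have "card (\<Union>x\<in>?I. bad x) < card ?C"
    by simp
  moreover have "finite (\<Union>x\<in>?I. bad x)"
    using finC by (auto simp: bad_def)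
  ultimately have "\<not> ?C \<subseteq> (\<Union>x\<in>?I. bad x)"
    using card_mono linorder_not_less by blast
  then obtain c where c: "c \<in> ?C" "c \<notin> (\<Union>x\<in>?I. bad x)"
    by blast
  have good: "(\<Sum>e\<in>E i. hits {s, t} c e) \<ge>
      real (card {s, t}) / real k ^ 2 * real (m i) - \<epsilon> powr (1/4) * real (m i)"
    if "i \<in> {1..l}" "s \<in> ?K" "t \<in> ?K" for i s t
  proof -
    have "c \<notin> bad (i, s, t)"
      using c(2) that by blast
    then show ?thesis
      using c(1) by (simp add: bad_def not_less)
  qed
  define P where "P = (\<lambda>s. {v \<in> V. c v = s})"
  have "partition_into k V P"
    using c(1) by (auto simp: partition_into_def disjoint_family_on_def P_def)
  moreover have "real (edges_between (E i) (P s) (P t))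
      \<ge> 2 * real (m i) / real k ^ 2 - \<epsilon> powr (1/4) * real (m i)"
    if "i \<in> {1..l}" "1 \<le> s \<and> s < t \<and> t \<le> k" for i s t
    using good[of i s t] that assms(5) by (simp add: P_def edges_between_colour_classes)
  moreover have "real (edges_within (E i) (P s))
      \<ge> real (m i) / real k ^ 2 - \<epsilon> powr (1/4) * real (m i)"
    if "i \<in> {1..l}" "s \<in> ?K" for i s
    \<comment> \<open>On the diagonal \<open>card {s, s}\<close> is 1, which gives the mean m / k^2
      in place of 2 m / k^2.\<close>
    using good[of i s s] that assms(5) by (simp add: P_def edges_within_colour_class)
  ultimately show ?thesis
    by blast
qed

end
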